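(* The proof system D-IR-calc is sound for DQBF: if the empty clause $\bot$ can be derived in D-IR-calc from a DQBF $\Pi\cdot\psi$ whose matrix $\psi$ is in CNF, then $\Pi\cdot\psi$ is false.
   Context: A DQBF $\Pi\cdot\psi$ has universal variables $Y$, existential variables $X$, and for each $x\in X$ a dependency set $Y_x\subseteq Y$; $\psi$ is a CNF over $X\cup Y$ (clauses are sets of literals). It is true iff there are Skolem functions $f_x:\{0,1\}^{Y_x}\to\{0,1\}$ ($x\in X$) such that for every $\alpha:Y\to\{0,1\}$, $\psi$ evaluates to $1$ under $\alpha$ extended by $x\mapsto f_x(\alpha\restriction Y_x)$; otherwise it is false. An annotated literal is $l^\tau$ where $l$ is a literal on an existential variable $x$ and $\tau$ is a partial assignment of variables in $Y_x$ to $\{0,1\}$. For a partial assignment $\tau$ of $Y$ and $x\in X$, $\mathrm{restrict}_x(\tau)$ is $\tau$ restricted to $\mathrm{dom}(\tau)\cap Y_x$. For a clause $C$ of annotated literals and partial assignment $\tau$ of universal variables, $\mathrm{instantiate}_\tau(C)$ is the clause of all $l^{\mathrm{restrict}_{\mathrm{var}(l)}(\sigma)}$ for $l^\xi\in C$, where $\mathrm{dom}(\sigma)=\mathrm{dom}(\xi)\cup\mathrm{dom}(\tau)$, $\sigma(u)=\xi(u)$ for $u\in\mathrm{dom}(\xi)$ and $\sigma(u)=\tau(u)$ otherwise. D-IR-calc derives clauses of annotated literals with the rules: (Axiom) from a non-tautological clause $C$ of $\psi$, derive $\{l^{\mathrm{restrict}_{\mathrm{var}(l)}(\tau)} : l\in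 C,\ \mathrm{var}(l)\in X\}$, where $\tau$ maps each universal variable $u$ occurring in $C$ to $0$ if the literal $u$ occurs in $C$ and to $1$ if $\neg u$ occurs in $C$; (Resolution) from $\{x^\tau\}\cup C_1$ and $\{\neg x^\tau\}\cup C_2$ derive $C_1\cup C_2$; (Instantiation) from $C$ derive $\mathrm{instantiate}_\tau(C)$ for any partial assignment $\tau$ of universal variables to $\{0,1\}$. *)

theory Defs
  imports Main
begin

datatype 'v literal = Pos (var: 'v) | Neg (var: 'v)

type_synonym 'v clause = "'v literal set"

(* A map m is read as a partial assignment with domain dom m; False is 0 and True is 1. *)
type_synonym 'v assignment = "'v \<Rightarrow> bool option"

record 'v dqbf =
  universals :: "'v set"
  existentials :: "'v set"
  deps :: "'v \<Rightarrow> 'v set"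
  matrix :: "'v clause set"

(* deps \<Phi> x is only meaningful for x \<in> existentials \<Phi>. *)
definition dqbf_wf :: "'v dqbf \<Rightarrow> bool" where
  "dqbf_wf \<Phi> \<longleftrightarrow>
     finite (universals \<Phi>) \<and> finite (existentials \<Phi>) \<and>
     universals \<Phi> \<inter> existentials \<Phi> = {} \<and>
     (\<forall>x \<in> existentials \<Phi>. deps \<Phi> x \<subseteq> universals \<Phi>) \<and>
     finite (matrix \<Phi>) \<and>
     (\<forall>C \<in> matrix \<Phi>. finite C \<and> var ` C \<subseteq> existentials \<Phi> \<union> universals \<Phi>)"

fun literal_true :: "'v assignment \<Rightarrow> 'v literal \<Rightarrow> bool" where
  "literal_true \<beta> (Pos v) \<longleftrightarrow> \<beta> v = Some True"
| "literal_true \<beta> (Neg v) \<longleftrightarrow> \<beta> v = Some False"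

definition cnf_true :: "'v assignment \<Rightarrow> 'v clause set \<Rightarrow> bool" where
  "cnf_true \<beta> \<psi> \<longleftrightarrow> (\<forall>C \<in> \<psi>. \<exists>l \<in> C. literal_true \<beta> l)"

definition restrict :: "'v dqbf \<Rightarrow> 'v \<Rightarrow> 'v assignment \<Rightarrow> 'v assignment" where
  "restrict \<Phi> x \<tau> = \<tau> |` deps \<Phi> x"

(* In a well-formed DQBF, f x is only ever applied to assignments with domain exactly deps \<Phi> x,
   so its values on other maps play no role. *)
definition skolem_extend ::
  "'v dqbf \<Rightarrow> ('v \<Rightarrow> 'v assignment \<Rightarrow> bool) \<Rightarrow> 'v assignment \<Rightarrow> 'v assignment" where
  "skolem_extend \<Phi> f \<alpha> =
     (\<lambda>v. if v \<in> existentials \<Phi> then Some (f v (restrict \<Phi> v \<alpha>)) else \<alpha> v)"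

definition dqbf_true :: "'v dqbf \<Rightarrow> bool" where
  "dqbf_true \<Phi> \<longleftrightarrow>
     (\<exists>f. \<forall>\<alpha>. dom \<alpha> = universals \<Phi> \<longrightarrow> cnf_true (skolem_extend \<Phi> f \<alpha>) (matrix \<Phi>))"

definition dqbf_false :: "'v dqbf \<Rightarrow> bool" where
  "dqbf_false \<Phi> \<longleftrightarrow> \<not> dqbf_true \<Phi>"

(* The pair (l, \<tau>) stands for l with annotation \<tau>. *)
type_synonym 'v annotated_literal = "'v literal \<times> 'v assignment"

definition is_annotated_literal :: "'v dqbf \<Rightarrow> 'v annotated_literal \<Rightarrow> bool" where
  "is_annotated_literal \<Phi> a \<longleftrightarrow>
     var (fst a) \<in> existentials \<Phi> \<and> dom (snd a) \<subseteq> deps \<Phi> (var (fst a))"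

(* In \<tau> ++ \<xi> the right operand \<xi> takes precedence. *)
definition instantiate ::
  "'v dqbf \<Rightarrow> 'v assignment \<Rightarrow> 'v annotated_literal set \<Rightarrow> 'v annotated_literal set" where
  "instantiate \<Phi> \<tau> C = {(l, restrict \<Phi> (var l) (\<tau> ++ \<xi>)) | l \<xi>. (l, \<xi>) \<in> C}"

definition tautological :: "'v clause \<Rightarrow> bool" where
  "tautological C \<longleftrightarrow> (\<exists>v. Pos v \<in> C \<and> Neg v \<in> C)"

definition falsifying_universal :: "'v dqbf \<Rightarrow> 'v clause \<Rightarrow> 'v assignment" where
  "falsifying_universal \<Phi> C =
     (\<lambda>u. if u \<in> universals \<Phi> \<and> Pos u \<in> C then Some False
          else if u \<in> universals \<Phi> \<and> Neg u \<in> C then Some True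
          else None)"

inductive D_IR_calc :: "'v dqbf \<Rightarrow> 'v annotated_literal set \<Rightarrow> bool" for \<Phi> where
  Axiom: "C \<in> matrix \<Phi> \<Longrightarrow> \<not> tautological C \<Longrightarrow>
    D_IR_calc \<Phi> {(l, restrict \<Phi> (var l) (falsifying_universal \<Phi> C)) | l.
                    l \<in> C \<and> var l \<in> existentials \<Phi>}"
| Resolution: "D_IR_calc \<Phi> ({(Pos x, \<tau>)} \<union> C\<^sub>1) \<Longrightarrow> D_IR_calc \<Phi> ({(Neg x, \<tau>)} \<union> C\<^sub>2) \<Longrightarrow>
    D_IR_calc \<Phi> (C\<^sub>1 \<union> C\<^sub>2)"
| Instantiation: "D_IR_calc \<Phi> C \<Longrightarrow> dom \<tau> \<subseteq> universals \<Phi> \<Longrightarrow>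
    D_IR_calc \<Phi> (instantiate \<Phi> \<tau> C)"

(* This is why the rules carry no side condition on literals and their annotations. *)
lemma D_IR_calc_annotated:
  assumes "D_IR_calc \<Phi> C" and "a \<in> C"
  shows "is_annotated_literal \<Phi> a"
  using assms
proof (induction arbitrary: a rule: D_IR_calc.induct)
  case (Axiom C)
  then show ?case
    by (auto simp: is_annotated_literal_def restrict_def restrict_map_def split: if_splits)
next
  case (Resolution x \<tau> C\<^sub>1 C\<^sub>2)
  then show ?case
    by blast
next
  case (Instantiation C \<tau>)
  then show ?case
    by (fastforce simp: is_annotated_literal_def instantiate_def restrict_def restrict_map_def split: if_splits)
qed

end

(* Suppose f is a winning choice of Skolem functions.  Every total assignment \<alpha> of the universal
   variables turns an annotated literal into a truth value: read the annotated variable x with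
   annotation \<xi> as the value of f x on \<alpha> overridden by \<xi>.  Then every derivable clause
   is true for all \<alpha>.  Axioms: under \<alpha> overridden by the falsifying assignment only an
   existential literal can satisfy the clause.  Resolution: complementary literals.
   Instantiation by \<tau>: use the premise for \<alpha> overridden by \<tau>.
   The empty clause is never true. *)
theory Submission
  imports Defs
begin

definition annotated_true ::
  "'v dqbf \<Rightarrow> ('v \<Rightarrow> 'v assignment \<Rightarrow> bool) \<Rightarrow> 'v assignment \<Rightarrow> 'v annotated_literal \<Rightarrow> bool" where
  "annotated_true \<Phi> f \<alpha> a \<longleftrightarrow> literal_true (skolem_extend \<Phi> f (\<alpha> ++ snd a)) (fst a)"

lemma literal_true_cong:
  "\<beta> (var l) = \<gamma> (var l) \<Longrightarrow> literal_true \<beta> l \<longleftrightarrow> literal_true \<gamma> l"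
  by (cases l) auto

text \<open>\<open>skolem_extend\<close> passes to each Skolem function only the values on its
  dependency set, so annotation entries outside that set are never read.\<close>

lemma annotated_true_restrict:
  assumes "var l \<in> existentials \<Phi>"
  shows "annotated_true \<Phi> f \<alpha> (l, restrict \<Phi> (var l) \<tau>) \<longleftrightarrow> annotated_true \<Phi> f \<alpha> (l, \<tau>)"
proof -
  have "restrict \<Phi> (var l) (\<alpha> ++ restrict \<Phi> (var l) \<tau>) = restrict \<Phi> (var l) (\<alpha> ++ \<tau>)"
    by (auto simp: restrict_def restrict_map_def map_add_def)
  then show ?thesis
    unfolding annotated_true_def fst_conv snd_conv
    using assms by (intro literal_true_cong) (simp add: skolem_extend_def)
qed

text \<open>Disjointness keeps \<open>skolem_extend\<close> from overwriting a universal variable.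
  The definition tests \<open>Pos u\<close> first, so \<open>Neg u\<close> is falsified only because
  \<open>C\<close> does not also contain \<open>Pos u\<close>.\<close>

lemma falsifying_universal_falsifies:
  assumes "universals \<Phi> \<inter> existentials \<Phi> = {}" and "\<not> tautological C"
    and "l \<in> C" and "var l \<in> universals \<Phi>"
  shows "\<not> literal_true (skolem_extend \<Phi> f (\<alpha> ++ falsifying_universal \<Phi> C)) l"
  using assms
  by (cases l)
    (auto simp: skolem_extend_def falsifying_universal_def tautological_def map_add_def)

lemma D_IR_calc_true:
  assumes wf: "dqbf_wf \<Phi>"
    and f: "\<And>\<alpha>. dom \<alpha> = universals \<Phi> \<Longrightarrow> cnf_true (skolem_extend \<Phi> f \<alpha>) (matrix \<Phi>)"
    and "D_IR_calc \<Phi> C" and "dom \<alpha> = universals \<Phi>"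
  shows "\<exists>a \<in> C. annotated_true \<Phi> f \<alpha> a"
  using assms(3,4)
proof (induction arbitrary: \<alpha> rule: D_IR_calc.induct)
  case (Axiom C)
  let ?\<tau> = "falsifying_universal \<Phi> C"
  have "dom (\<alpha> ++ ?\<tau>) = universals \<Phi>"
    using Axiom.prems by (auto simp: falsifying_universal_def split: if_splits)
  then obtain l where l: "l \<in> C" "literal_true (skolem_extend \<Phi> f (\<alpha> ++ ?\<tau>)) l"
    using f Axiom.hyps unfolding cnf_true_def by blast
  then have "var l \<in> existentials \<Phi>"
    using wf Axiom.hyps falsifying_universal_falsifies[of \<Phi> C l f \<alpha>]
    unfolding dqbf_wf_def by blast
  moreover from this have "annotated_true \<Phi> f \<alpha> (l, restrict \<Phi> (var l) ?\<tau>)"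
    using l by (simp add: annotated_true_restrict) (simp add: annotated_true_def)
  ultimately show ?case
    using l by blast
next
  case (Resolution x \<tau> C\<^sub>1 C\<^sub>2)
  \<comment> \<open>Both pivots carry the same annotation, hence read the same value of
    \<open>x\<close>.\<close>
  have "\<not> (annotated_true \<Phi> f \<alpha> (Pos x, \<tau>) \<and> annotated_true \<Phi> f \<alpha> (Neg x, \<tau>))"
    by (simp add: annotated_true_def)
  then show ?case
    using Resolution.IH[OF Resolution.prems] by blast
next
  case (Instantiation C \<tau>)
  then have "dom (\<alpha> ++ \<tau>) = universals \<Phi>"
    by auto
  from Instantiation.IH[OF this]
  obtain l \<xi> where l: "(l, \<xi>) \<in> C" "annotated_true \<Phi> f (\<alpha> ++ \<tau>) (l, \<xi>)"
    by auto
  then have "var l \<in> existentials \<Phi>"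
    using D_IR_calc_annotated[OF Instantiation.hyps(1) l(1)] by (simp add: is_annotated_literal_def)
  \<comment> \<open>Associativity of \<open>++\<close>: the premise reads
    \<open>(\<alpha> ++ \<tau>) ++ \<xi>\<close>, the conclusion
    \<open>\<alpha> ++ (\<tau> ++ \<xi>)\<close>.\<close>
  then have "annotated_true \<Phi> f \<alpha> (l, restrict \<Phi> (var l) (\<tau> ++ \<xi>))"
    using l by (simp add: annotated_true_restrict) (simp add: annotated_true_def)
  then show ?case
    using l unfolding instantiate_def by blast
qed

theorem theorem1:
  fixes \<Phi> :: "'v dqbf"
  assumes "dqbf_wf \<Phi>"
    and "D_IR_calc \<Phi> {}"
  shows "dqbf_false \<Phi>"
  unfolding dqbf_false_def
proof
  assume "dqbf_true \<Phi>"
  then obtain f where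
    f: "\<And>\<alpha>. dom \<alpha> = universals \<Phi> \<Longrightarrow> cnf_true (skolem_extend \<Phi> f \<alpha>) (matrix \<Phi>)"
    unfolding dqbf_true_def by blast
  \<comment> \<open>Any total assignment of the universal variables would serve here; the constant
    one shows that one exists.\<close>
  have "dom ((\<lambda>_. Some True) |` universals \<Phi>) = universals \<Phi>"
    by auto
  from D_IR_calc_true[OF assms(1) f assms(2) this] show False
    by simp
qed

end
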